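(* For every integer $n\ge 1$ and all integers $x_1,\dots,x_n$ (equivalently, as polynomials in $x_1,\dots,x_n$), $G_n(x_1,\dots,x_n)=F_n(x_1,\dots,x_n)$.
   Context: The functions $F_n$ are defined recursively by $F_1(x_1)=x_1$ and, for $i\ge 1$, $F_{i+1}(x_1,\dots,x_i,x_{i+1})=F_i(x_1,\dots,x_{i-1},x_i-1)+(x_{i+1}-1)\cdot F_i(x_1,\dots,x_i)$. For non-negative integers $i,j$, let $C_{i,j}$ be the set of subsets $I\subseteq\{1,\dots,j\}$ with $|I|=i$ such that (a) whenever $a<b$ are elements of $I$ with no element of $I$ strictly between them, $b-a$ is odd, and (b) $j-\max(I)$ is even, with the convention $\max(\emptyset)=0$. Define $\gamma_{i,j}(x_1,\dots,x_j)=\sum_{I\in C_{i,j}}\prod_{m\in I}x_m$ (the empty product being $1$, and the empty sum $0$). Define $G_n(x_1,\dots,x_n)=\gamma_{n,n}-\gamma_{n-2,n}+\gamma_{n-4,n}-\gamma_{n-6,n}+\cdots$, the sum continuing as long as the first subscript is non-negative, i.e. $G_n=\sum_{0\le m\le n/2}(-1)^m\gamma_{n-2m,n}$. *)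

theory Defs
  imports Main
begin

text \<open>A tuple \<open>(x\<^sub>1, \<dots>, x\<^sub>n)\<close> is represented by a function \<open>x :: nat \<Rightarrow> int\<close>, of which only the
  values at \<open>1, \<dots>, n\<close> are used. There is no \<open>F\<^sub>0\<close>, so \<open>F 0\<close> is left unspecified.\<close>

fun F :: "nat \<Rightarrow> (nat \<Rightarrow> int) \<Rightarrow> int" where
  "F (Suc 0) x = x 1"
| "F (Suc (Suc k)) x =
     (let i = Suc k in F i (x(i := x i - 1)) + (x (i + 1) - 1) * F i x)"

definition max0 :: "nat set \<Rightarrow> nat" where
  "max0 I = (if I = {} then 0 else Max I)"

definition C :: "nat \<Rightarrow> nat \<Rightarrow> nat set set" where
  "C i j = {I. I \<subseteq> {1..j} \<and> card I = i \<and>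
     (\<forall>a\<in>I. \<forall>b\<in>I. a < b \<and> \<not> (\<exists>c\<in>I. a < c \<and> c < b) \<longrightarrow> odd (b - a)) \<and>
     even (j - max0 I)}"

definition gamma :: "nat \<Rightarrow> nat \<Rightarrow> (nat \<Rightarrow> int) \<Rightarrow> int" where
  "gamma i j x = (\<Sum>I\<in>C i j. \<Prod>m\<in>I. x m)"

definition G :: "nat \<Rightarrow> (nat \<Rightarrow> int) \<Rightarrow> int" where
  "G n x = (\<Sum>m | 2 * m \<le> n. (- 1) ^ m * gamma (n - 2 * m) n x)"

end

theory Submission
  imports Defs
begin

text \<open>Both sides are the signed continuant: \<open>F\<close> and \<open>G\<close> satisfy
  \<open>K\<^sub>1 = x\<^sub>1\<close>, \<open>K\<^sub>2 = x\<^sub>1 x\<^sub>2 - 1\<close> and \<open>K\<^sub>n\<^sub>+\<^sub>2 = x\<^sub>n\<^sub>+\<^sub>2 K\<^sub>n\<^sub>+\<^sub>1 - K\<^sub>n\<close>.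
  For \<open>F\<close>, the recurrence shows by induction that lowering the last argument by one subtracts \<open>K\<^sub>n\<close>
  from \<open>K\<^sub>n\<^sub>+\<^sub>1\<close>. For \<open>G\<close>, the index sets either contain \<open>n + 2\<close>, and removing it leaves an index
  set for \<open>n + 1\<close>, or have maximum at most \<open>n\<close> by parity, and are index sets for \<open>n\<close>.\<close>

fun continuant :: "nat \<Rightarrow> (nat \<Rightarrow> 'a::comm_ring_1) \<Rightarrow> 'a" where
  "continuant 0 x = 1"
| "continuant (Suc 0) x = x 1"
| "continuant (Suc (Suc n)) x = x (Suc (Suc n)) * continuant (Suc n) x - continuant n x"

lemma continuant_upd_greater: "n < i \<Longrightarrow> continuant n (x(i := a)) = continuant n x"
  by (induction n x rule: continuant.induct) auto

text \<open>The continuant is affine in its last variable with slope \<open>continuant n x\<close>,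
  since the remaining terms do not involve that variable; for \<open>n = 0\<close> the slope is the
  value \<open>1\<close> at index \<open>0\<close>.\<close>

lemma continuant_upd_last:
  "continuant (Suc n) (x(Suc n := x (Suc n) - 1)) = continuant (Suc n) x - continuant n x"
  by (cases n) (auto simp: continuant_upd_greater algebra_simps)

lemma F_eq_continuant: "F (Suc n) x = continuant (Suc n) x"
proof (induction n arbitrary: x)
  case 0
  show ?case by simp
next
  case (Suc n)
  have "F (Suc (Suc n)) x = F (Suc n) (x(Suc n := x (Suc n) - 1)) + (x (Suc (Suc n)) - 1) * F (Suc n) x"
    by (simp add: Let_def)
  \<comment> \<open>The induction hypothesis is used at \<open>x\<close> and at the lowered tuple.
    The extra \<open>- continuant (Suc n) x\<close> from the factor
    \<open>x (Suc (Suc n)) - 1\<close> cancels the first summand up to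
    \<open>- continuant n x\<close>.\<close>
  then show ?case
    unfolding Suc continuant_upd_last by (simp add: algebra_simps)
qed

text \<open>The union of the index sets of all the \<open>\<gamma>\<close> occurring in \<open>G\<^sub>n\<close>.\<close>

definition odd_gap_sets :: "nat \<Rightarrow> nat set set" where
  "odd_gap_sets n = {I. I \<in> C (card I) n \<and> even (n + card I)}"

lemma odd_gap_sets_iff:
  "I \<in> odd_gap_sets n \<longleftrightarrow> I \<subseteq> {1..n} \<and> even (n + card I) \<and> even (n - max0 I) \<and>
     (\<forall>a\<in>I. \<forall>b\<in>I. a < b \<and> \<not> (\<exists>c\<in>I. a < c \<and> c < b) \<longrightarrow> odd (b - a))"
  unfolding odd_gap_sets_def C_def by blast

lemma finite_odd_gap_sets: "finite (odd_gap_sets n)"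
  by (rule finite_subset[of _ "Pow {1..n}"]) (use odd_gap_sets_iff in blast, simp)

lemma card_le_of_odd_gap_sets: "I \<in> odd_gap_sets n \<Longrightarrow> card I \<le> n"
  using card_mono[of "{1..n}" I] by (simp add: odd_gap_sets_iff)

lemma max0_le: "I \<subseteq> {1..n} \<Longrightarrow> max0 I \<le> n"
  using finite_subset[of I "{1..n}"] Max_in[of I] by (auto simp: max0_def)

lemma le_max0: "I \<subseteq> {1..n} \<Longrightarrow> a \<in> I \<Longrightarrow> a \<le> max0 I"
  using finite_subset[of I "{1..n}"] by (auto simp: max0_def)

lemma max0_in: "I \<subseteq> {1..n} \<Longrightarrow> I \<noteq> {} \<Longrightarrow> max0 I \<in> I"
  using finite_subset[of I "{1..n}"] by (auto simp: max0_def)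

lemma max0_insert: "I \<subseteq> {1..n} \<Longrightarrow> max0 (insert (Suc n) I) = Suc n"
  using finite_subset[of I "{1..n}"] by (auto simp: max0_def intro!: Max_eqI)

text \<open>The only new consecutive pair is \<open>max0 I\<close> and \<open>Suc n\<close>, so the
  parity condition on \<open>n - max0 I\<close> turns into the odd-gap condition for that pair; the
  condition on the new maximum is trivial.\<close>

lemma insert_Suc_in_odd_gap_sets_iff:
  assumes I: "I \<subseteq> {1..n}"
  shows "insert (Suc n) I \<in> odd_gap_sets (Suc n) \<longleftrightarrow> I \<in> odd_gap_sets n"
proof -
  have fin: "finite I" and nin: "Suc n \<notin> I"
    using I finite_subset by auto
  have le: "a \<le> n" if "a \<in> I" for a using I that by auto
  have sub: "insert (Suc n) I \<subseteq> {1..Suc n}" using I by force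
  let ?gap = "\<lambda>J a b. a < b \<and> \<not> (\<exists>c\<in>J. a < c \<and> c < b) \<longrightarrow> odd (b - a)"
  have gap_old: "?gap (insert (Suc n) I) a b \<longleftrightarrow> ?gap I a b" if "b \<in> I" for a b
    using le[OF that] by auto
  have gap_new: "(\<forall>a\<in>I. ?gap (insert (Suc n) I) a (Suc n)) \<longleftrightarrow> (I = {} \<or> even (n - max0 I))"
  proof (cases "I = {}")
    case False
    \<comment> \<open>For any other \<open>a\<close>, the element \<open>max0 I\<close> lies
      strictly between \<open>a\<close> and \<open>Suc n\<close>, so the condition is
      vacuous.\<close>
    have "?gap (insert (Suc n) I) a (Suc n) \<longleftrightarrow> (a = max0 I \<longrightarrow> even (n - max0 I))" if a: "a \<in> I" for a
    proof (cases "a = max0 I")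
      case True
      then have "\<not> (\<exists>c\<in>insert (Suc n) I. a < c \<and> c < Suc n)"
        using le_max0[OF I] by force
      moreover have "Suc n - a = Suc (n - max0 I)"
        using True max0_le[OF I] by auto
      ultimately show ?thesis
        using True le[OF a] by auto
    next
      case ne: False
      then have "a < max0 I" using le_max0[OF I a] by simp
      then show ?thesis
        using ne max0_in[OF I False] max0_le[OF I] by auto
    qed
    then show ?thesis using False max0_in[OF I False] by auto
  qed simp
  have split: "(\<forall>a\<in>insert (Suc n) I. \<forall>b\<in>insert (Suc n) I. P a b) \<longleftrightarrow>
      (\<forall>a\<in>I. \<forall>b\<in>I. P a b) \<and> (\<forall>a\<in>I. P a (Suc n))"
    if "\<And>b. b \<in> insert (Suc n) I \<Longrightarrow> P (Suc n) b" for P :: "nat \<Rightarrow> nat \<Rightarrow> bool"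
    using that by blast
  have "(\<forall>a\<in>insert (Suc n) I. \<forall>b\<in>insert (Suc n) I. ?gap (insert (Suc n) I) a b) \<longleftrightarrow>
      (\<forall>a\<in>I. \<forall>b\<in>I. ?gap (insert (Suc n) I) a b) \<and> (\<forall>a\<in>I. ?gap (insert (Suc n) I) a (Suc n))"
    by (rule split) (use le in force)
  also have "\<dots> \<longleftrightarrow> (\<forall>a\<in>I. \<forall>b\<in>I. ?gap I a b) \<and> (I = {} \<or> even (n - max0 I))"
    unfolding gap_new by (simp only: gap_old cong: ball_cong)
  finally have gaps: "(\<forall>a\<in>insert (Suc n) I. \<forall>b\<in>insert (Suc n) I. ?gap (insert (Suc n) I) a b) \<longleftrightarrow>
      (\<forall>a\<in>I. \<forall>b\<in>I. ?gap I a b) \<and> (I = {} \<or> even (n - max0 I))" .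
  have "even (Suc n + card (insert (Suc n) I)) \<longleftrightarrow> even (n + card I)"
    using fin nin by simp
  \<comment> \<open>An empty \<open>I\<close> gives no new pair; the cardinality parity then
    supplies the missing condition, as \<open>max0 {} = 0\<close>.\<close>
  moreover have "even (n + card I) \<Longrightarrow> I = {} \<Longrightarrow> even (n - max0 I)"
    by (simp add: max0_def)
  ultimately show ?thesis
    unfolding odd_gap_sets_iff max0_insert[OF I] gaps using I sub by auto
qed

text \<open>Parity rules out the maximum \<open>Suc n\<close>, and shifting \<open>n\<close> by two
  changes no parity.\<close>

lemma Suc_Suc_notin_odd_gap_sets_iff:
  "I \<in> odd_gap_sets (Suc (Suc n)) \<and> Suc (Suc n) \<notin> I \<longleftrightarrow> I \<in> odd_gap_sets n"
proof -
  have "I \<subseteq> {1..n} \<and> even (n - max0 I)"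
    if I: "I \<subseteq> {1..Suc (Suc n)}" and ev: "even (Suc (Suc n) - max0 I)" and nin: "Suc (Suc n) \<notin> I"
  proof -
    have "max0 I \<noteq> Suc (Suc n)"
      using max0_in[OF I] nin by (cases "I = {}") (auto simp: max0_def)
    moreover have "max0 I \<noteq> Suc n"
      using ev by auto
    ultimately have "max0 I \<le> n"
      using max0_le[OF I] by simp
    then show ?thesis
      using ev I le_max0[OF I] by (fastforce simp: Suc_diff_le)
  qed
  moreover have "I \<subseteq> {1..Suc (Suc n)} \<and> even (Suc (Suc n) - max0 I) \<and> Suc (Suc n) \<notin> I"
    if "I \<subseteq> {1..n}" and "even (n - max0 I)"
    using that max0_le[OF that(1)] by (fastforce simp: Suc_diff_le)
  ultimately show ?thesis
    unfolding odd_gap_sets_iff by auto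
qed

lemma odd_gap_sets_rec:
  "odd_gap_sets (Suc (Suc n)) = insert (Suc (Suc n)) ` odd_gap_sets (Suc n) \<union> odd_gap_sets n"
    (is "?L = ?R")
proof (intro set_eqI iffI)
  fix I assume I: "I \<in> ?L"
  show "I \<in> ?R"
  proof (cases "Suc (Suc n) \<in> I")
    case True
    define J where "J = I - {Suc (Suc n)}"
    have IJ: "I = insert (Suc (Suc n)) J" using True by (auto simp: J_def)
    have "J \<subseteq> {1..Suc n}"
      using I by (force simp: J_def odd_gap_sets_iff le_Suc_eq)
    then show ?thesis
      using insert_Suc_in_odd_gap_sets_iff I IJ by blast
  qed (use I Suc_Suc_notin_odd_gap_sets_iff in blast)
next
  fix I assume "I \<in> ?R"
  then show "I \<in> ?L"
  proof
    assume "I \<in> insert (Suc (Suc n)) ` odd_gap_sets (Suc n)"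
    then obtain J where "I = insert (Suc (Suc n)) J" "J \<in> odd_gap_sets (Suc n)" by blast
    moreover from this have "J \<subseteq> {1..Suc n}" by (simp add: odd_gap_sets_iff)
    ultimately show ?thesis by (simp add: insert_Suc_in_odd_gap_sets_iff)
  qed (use Suc_Suc_notin_odd_gap_sets_iff in blast)
qed

text \<open>The index sets of the summands of \<open>G\<close> are the fibres of
  \<open>(n - card I) div 2\<close>, which turns the double sum into a single one. Since
  \<open>n - card I\<close> is even, halving loses nothing.\<close>

lemma C_eq_odd_gap_sets:
  assumes "2 * m \<le> n"
  shows "C (n - 2 * m) n = {I \<in> odd_gap_sets n. (n - card I) div 2 = m}"
proof (intro set_eqI iffI)
  fix I assume "I \<in> C (n - 2 * m) n"
  moreover from this have "card I = n - 2 * m" by (simp add: C_def)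
  ultimately show "I \<in> {I \<in> odd_gap_sets n. (n - card I) div 2 = m}"
    using assms by (simp add: odd_gap_sets_def)
next
  fix I assume I: "I \<in> {I \<in> odd_gap_sets n. (n - card I) div 2 = m}"
  then have "card I \<le> n" "even (n + card I)" "(n - card I) div 2 = m"
    using card_le_of_odd_gap_sets by (auto simp: odd_gap_sets_iff)
  then have "card I = n - 2 * m" by presburger
  then show "I \<in> C (n - 2 * m) n"
    using I by (simp add: odd_gap_sets_def)
qed

lemma G_eq_sum_odd_gap_sets:
  "G n x = (\<Sum>I\<in>odd_gap_sets n. (- 1) ^ ((n - card I) div 2) * (\<Prod>i\<in>I. x i))"
proof -
  let ?h = "\<lambda>I. (- 1) ^ ((n - card I) div 2) * (\<Prod>i\<in>I. x i)"
  have fin: "finite {m. 2 * m \<le> n}"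
    by (rule finite_subset[of _ "{..n}"]) auto
  have "G n x = (\<Sum>m | 2 * m \<le> n. \<Sum>I | I \<in> odd_gap_sets n \<and> (n - card I) div 2 = m. ?h I)"
    unfolding G_def gamma_def
    by (intro sum.cong) (auto simp: C_eq_odd_gap_sets sum_distrib_left)
  also have "\<dots> = (\<Sum>I\<in>odd_gap_sets n. ?h I)"
    by (rule sum.group[OF finite_odd_gap_sets fin]) auto
  finally show ?thesis .
qed

text \<open>Inserting \<open>n + 2\<close> raises index and cardinality gap alike and keeps the sign
  exponent relative to \<open>n + 1\<close>; regarding a set for \<open>n\<close> as one for
  \<open>n + 2\<close> raises the exponent by one and flips the sign.\<close>

lemma G_rec: "G (Suc (Suc n)) x = x (Suc (Suc n)) * G (Suc n) x - G n x"
proof -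
  let ?N = "Suc (Suc n)"
  let ?h = "\<lambda>k I. (- 1) ^ ((k - card I) div 2) * (\<Prod>i\<in>I. x i)"
  have new: "?N \<notin> I" "finite I" if "I \<in> odd_gap_sets (Suc n)" for I
    using that finite_subset[of I "{1..Suc n}"] by (auto simp: odd_gap_sets_iff)
  have inj: "inj_on (insert ?N) (odd_gap_sets (Suc n))"
    by (rule inj_onI) (metis insert_ident new(1))
  have disj: "insert ?N ` odd_gap_sets (Suc n) \<inter> odd_gap_sets n = {}"
    by (auto simp: odd_gap_sets_iff)
  have "G ?N x = (\<Sum>I\<in>odd_gap_sets (Suc n). ?h ?N (insert ?N I)) + (\<Sum>I\<in>odd_gap_sets n. ?h ?N I)"
    unfolding G_eq_sum_odd_gap_sets odd_gap_sets_rec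
    by (simp add: sum.union_disjoint finite_odd_gap_sets disj sum.reindex[OF inj])
  also have "(\<Sum>I\<in>odd_gap_sets (Suc n). ?h ?N (insert ?N I)) = x ?N * G (Suc n) x"
    unfolding G_eq_sum_odd_gap_sets sum_distrib_left
    by (intro sum.cong) (auto simp: new)
  also have "(\<Sum>I\<in>odd_gap_sets n. ?h ?N I) = - G n x"
    unfolding G_eq_sum_odd_gap_sets sum_negf[symmetric]
  proof (intro sum.cong refl)
    fix I assume "I \<in> odd_gap_sets n"
    then have "card I \<le> n" by (rule card_le_of_odd_gap_sets)
    then have "?N - card I = Suc (Suc (n - card I))" by linarith
    then show "?h ?N I = - ?h n I" by simp
  qed
  finally show ?thesis by simp
qed

lemma G_eq_continuant: "G n x = continuant n x"
proof (induction n x rule: continuant.induct)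
  case (1 x)
  have "odd_gap_sets 0 = {{}}"
    by (auto simp: odd_gap_sets_iff max0_def)
  then show ?case by (simp add: G_eq_sum_odd_gap_sets)
next
  case (2 x)
  \<comment> \<open>The empty set fails because \<open>1 - max0 {} = 1\<close> is odd.\<close>
  have "odd_gap_sets (Suc 0) = {{1}}"
    by (auto simp: odd_gap_sets_iff max0_def subset_singleton_iff)
  then show ?case by (simp add: G_eq_sum_odd_gap_sets)
next
  case (3 n x)
  then show ?case by (simp add: G_rec)
qed

theorem theorem3:
  fixes n :: nat and x :: "nat \<Rightarrow> int"
  assumes "n \<ge> 1"
  shows "G n x = F n x"
  using assms by (cases n) (simp_all add: G_eq_continuant F_eq_continuant del: F.simps)

end
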